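(* Let $\mathcal{Z}:=\{S\subseteq\mathbb{N}: \lim_{n\to\infty}|S\cap[0,n]|/n=0\}$, and let $\Sigma(\mathcal{Z})$ be the family of sets $A\subseteq\mathbb{N}$ for which there are no $B,C\subseteq\mathbb{N}$ with $|B|,|C|\ge 2$ and $A\bigtriangleup(B+C)\in\mathcal{Z}$. Identify each infinite set $S\subseteq\mathbb{N}$ with the real number $\sum_{n\in S}2^{-(n+1)}\in(0,1]$ (i.e., via its unique nonterminating dyadic expansion), and let $\lambda$ denote Lebesgue measure on $(0,1]$ (completion of the Borel $\sigma$-algebra). Then $\lambda(\Sigma(\mathcal{Z}))=1$, i.e., the set of reals in $(0,1]$ corresponding to infinite sets in $\Sigma(\mathcal{Z})$ is Lebesgue measurable with measure $1$.
   Context: $\mathbb{N}$ denotes the set of nonnegative integers; $B+C:=\{b+c: b\in B, c\in C\}$; $\bigtriangleup$ denotes symmetric difference. *)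

theory Defs
  imports "HOL-Analysis.Analysis" "HOL-Library.Set_Algebras"
begin

definition density_zero_ideal :: "nat set set" (\<open>\<Z>\<close>) where
  "\<Z> = {S. (\<lambda>n. real (card (S \<inter> {0..n})) / real n) \<longlonglongrightarrow> 0}"

text \<open>A possibly infinite set has cardinality at least two; \<^const>\<open>card\<close> alone does not
  express this, since it is \<open>0\<close> on infinite sets.\<close>

definition at_least_two :: "'a set \<Rightarrow> bool" where
  "at_least_two B \<longleftrightarrow> infinite B \<or> card B \<ge> 2"

text \<open>The sum \<open>B + C\<close> is the elementwise sum of sets from \<^theory>\<open>HOL-Library.Set_Algebras\<close>.\<close>

definition Sigma_class :: "nat set set \<Rightarrow> nat set set" (\<open>\<Sigma>\<close>) where
  "\<Sigma> I = {A. \<not> (\<exists>B C :: nat set. at_least_two B \<and> at_least_two C \<and>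
                     (A - (B + C)) \<union> ((B + C) - A) \<in> I)}"

text \<open>On infinite sets this is the bijection onto the half-open interval \<open>(0,1]\<close> given by
  nonterminating dyadic expansions.\<close>

definition dyadic_real :: "nat set \<Rightarrow> real" where
  "dyadic_real S = (\<Sum>\<^sub>\<infinity>n\<in>S. 1 / 2 ^ (n + 1))"

end

theory Submission
  imports Defs
begin

text \<open>The dyadic digits of a uniform point of \<open>(0,1]\<close> are independent fair bits, so it suffices to treat a
  random set \<open>A\<close>. Suppose \<open>A\<close> differs from \<open>B + C\<close> by a set of density zero.

  If \<open>B\<close> is finite with at least two elements, every element of \<open>B + C\<close> has another one within
  \<open>Max B\<close>, whereas isolated elements of \<open>A\<close> have positive density.

  If \<open>B\<close> and \<open>C\<close> are infinite, choose \<open>F \<subseteq> B\<close> with six elements: up to density zero, \<open>C\<close> lies in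
  \<open>{c. c + F \<subseteq> A}\<close>, which has density \<open>1/64\<close>, and likewise for \<open>B\<close>. So for suitable large \<open>n\<close> the
  set \<open>A \<inter> [0,n)\<close> is determined by three subsets of \<open>[0,n)\<close> with at most \<open>n/32\<close> elements each, and the
  number of such triples is exponentially smaller than \<open>2^n\<close>.

  Both densities come from Chebyshev's inequality and the Borel--Cantelli lemma along the lengths
  \<open>n = 32 * 2^m\<close>; these grow fast enough to make the \<open>O(1/n)\<close> bound summable.\<close>

subsection \<open>Dyadic digits\<close>

text \<open>\<open>\<lceil>y\<rceil> - 1\<close> in place of \<open>\<lfloor>y\<rfloor>\<close> selects the nonterminating expansion at dyadic rationals.\<close>

definition bits :: "real \<Rightarrow> nat set" where
  "bits x = {n. odd (\<lceil>2 ^ Suc n * x\<rceil> - 1)}"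

text \<open>Doubling \<open>y\<close> appends one binary digit to
  \<open>\<lceil>y\<rceil> - 1\<close>, and the parity of the result is that digit. This drives the
  induction for the partial sums.\<close>

lemma ceiling_double:
  fixes y :: real
  shows "\<lceil>2 * y\<rceil> - 1 = 2 * (\<lceil>y\<rceil> - 1) + (if odd (\<lceil>2 * y\<rceil> - 1) then 1 else 0)"
proof -
  have "\<lceil>2 * y\<rceil> - 1 = 2 * (\<lceil>y\<rceil> - 1) \<or> \<lceil>2 * y\<rceil> - 1 = 2 * (\<lceil>y\<rceil> - 1) + 1"
  proof -
    have "\<lceil>2 * y\<rceil> \<le> 2 * \<lceil>y\<rceil>" by (rule ceiling_le) (simp add: le_of_int_ceiling)
    moreover have "2 * \<lceil>y\<rceil> - 2 < \<lceil>2 * y\<rceil>"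
      using ceiling_correct[of y] by (subst less_ceiling_iff) simp
    ultimately show ?thesis by presburger
  qed
  then show ?thesis by auto
qed

text \<open>The right side is the largest multiple of \<open>1 / 2 ^ N\<close> strictly below
  \<open>x\<close>; passing from \<open>N\<close> to \<open>Suc N\<close> appends one digit by
  \<open>ceiling_double\<close>.\<close>

lemma bits_partial_sum:
  assumes "x \<in> {0<..1}"
  shows "(\<Sum>n\<in>bits x \<inter> {..<N}. 1 / 2 ^ Suc n) = real_of_int (\<lceil>2 ^ N * x\<rceil> - 1) / 2 ^ N"
proof (induction N)
  case 0
  have "\<lceil>x\<rceil> = 1" using assms by (simp add: ceiling_eq_iff)
  then show ?case by simp
next
  case (Suc N)
  have *: "bits x \<inter> {..<Suc N} = (if N \<in> bits x then insert N (bits x \<inter> {..<N}) else bits x \<inter> {..<N})"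
    by (auto simp: less_Suc_eq)
  have "(\<Sum>n\<in>bits x \<inter> {..<Suc N}. 1 / 2 ^ Suc n)
      = (\<Sum>n\<in>bits x \<inter> {..<N}. 1 / 2 ^ Suc n) + (if N \<in> bits x then 1 / 2 ^ Suc N else (0::real))"
    unfolding * by simp
  also have "\<dots> = real_of_int (2 * (\<lceil>2 ^ N * x\<rceil> - 1) + (if N \<in> bits x then 1 else 0)) / 2 ^ Suc N"
    unfolding Suc.IH by (simp add: field_simps)
  also have "2 * (\<lceil>2 ^ N * x\<rceil> - 1) + (if N \<in> bits x then 1 else 0) = \<lceil>2 ^ Suc N * x\<rceil> - 1"
    using ceiling_double[of "2 ^ N * x"] by (simp add: bits_def mult.assoc)
  finally show ?case .
qed

lemma bits_approx:
  assumes "x \<in> {0<..1}"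
  defines "s \<equiv> \<lambda>N. \<Sum>n\<in>bits x \<inter> {..<N}. 1 / 2 ^ Suc n"
  shows "s N < x" and "x \<le> s N + 1 / 2 ^ N"
proof -
  have "real_of_int (\<lceil>2 ^ N * x\<rceil> - 1) < 2 ^ N * x" "2 ^ N * x \<le> real_of_int (\<lceil>2 ^ N * x\<rceil> - 1) + 1"
    by linarith+
  then show "s N < x" "x \<le> s N + 1 / 2 ^ N"
    unfolding s_def bits_partial_sum[OF assms(1)] by (simp_all add: field_simps)
qed

text \<open>If the digits stopped, the partial sums would stay at a fixed positive distance below
  \<open>x\<close>, while \<open>bits_approx\<close> bounds that distance by arbitrarily small
  powers of 1/2.\<close>

lemma infinite_bits:
  assumes "x \<in> {0<..1}"
  shows "infinite (bits x)"
proof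
  assume "finite (bits x)"
  then obtain M where M: "bits x \<subseteq> {..<M}"
    by (metis finite_nat_iff_bounded)
  let ?s = "\<Sum>n\<in>bits x. 1 / 2 ^ Suc n :: real"
  have s: "bits x \<inter> {..<M + k} = bits x" for k using M by auto
  have "?s < x" using bits_approx(1)[OF assms, of "M + 0"] unfolding s .
  then obtain k where "(1/2) ^ k < x - ?s"
    using real_arch_pow_inv[of "x - ?s" "1/2"] by auto
  moreover have "x \<le> ?s + 1 / 2 ^ (M + k)" using bits_approx(2)[OF assms, of "M + k"] unfolding s .
  moreover have "1 / 2 ^ (M + k) \<le> (1/2 :: real) ^ k"
    by (simp add: power_one_over frac_le)
  ultimately show False by linarith
qed

text \<open>The terms are nonnegative, so the unordered sum in \<open>dyadic_real\<close> agrees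
  with the limit of the ordered partial sums.\<close>

lemma dyadic_real_eqI:
  assumes "(\<lambda>N. \<Sum>n\<in>S \<inter> {..<N}. 1 / 2 ^ Suc n) \<longlonglongrightarrow> x"
  shows "dyadic_real S = x"
proof -
  let ?f = "\<lambda>n. if n \<in> S then 1 / 2 ^ Suc n else (0::real)"
  have "(\<Sum>n<N. ?f n) = (\<Sum>n\<in>S \<inter> {..<N}. 1 / 2 ^ Suc n)" for N
    by (simp add: sum.If_cases Int_commute)
  then have "?f sums x" using assms by (simp add: sums_def)
  then have "(?f has_sum x) UNIV" by (rule sums_nonneg_imp_has_sum) simp
  then have "((\<lambda>n. 1 / 2 ^ Suc n) has_sum x) S"
    by (rule has_sum_cong_neutral[THEN iffD1, rotated -1]) auto
  then show ?thesis unfolding dyadic_real_def by (simp add: infsumI)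
qed

lemma dyadic_real_bits:
  assumes "x \<in> {0<..1}"
  shows "dyadic_real (bits x) = x"
proof (rule dyadic_real_eqI, rule tendsto_sandwich)
  show "\<forall>\<^sub>F N in sequentially. (x - (1/2) ^ N) \<le> (\<Sum>n\<in>bits x \<inter> {..<N}. 1 / 2 ^ Suc n)"
    using bits_approx(2)[OF assms] by (auto simp: power_one_over algebra_simps)
  show "\<forall>\<^sub>F N in sequentially. (\<Sum>n\<in>bits x \<inter> {..<N}. 1 / 2 ^ Suc n) \<le> x"
    using bits_approx(1)[OF assms] by (intro always_eventually allI less_imp_le)
  show "(\<lambda>N. x - (1/2) ^ N) \<longlonglongrightarrow> x"
    using tendsto_diff[OF tendsto_const LIMSEQ_realpow_zero[of "1/2"], of x] by simp
qed simp

lemma dyadic_real_mem: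
  assumes "infinite S"
  shows "dyadic_real S \<in> {0<..1}"
proof -
  let ?f = "\<lambda>n. 1 / 2 ^ (n + 1) :: real"
  have sums: "?f sums 1" using power_half_series by (simp add: power_one_over)
  then have f: "(?f has_sum 1) UNIV" by (rule sums_nonneg_imp_has_sum) simp
  then have S: "?f summable_on S"
    using summable_on_subset_banach has_sum_imp_summable by blast
  obtain k where "k \<in> S" using assms by (metis finite.emptyI equals0I)
  have "infsum ?f S \<le> infsum ?f UNIV"
    using f S by (intro infsum_mono2) (auto simp: summable_on_def)
  moreover have "infsum ?f {k} \<le> infsum ?f S"
    using S \<open>k \<in> S\<close> by (intro infsum_mono2) auto
  moreover have "infsum ?f {k} > 0" by simp
  ultimately have "infsum ?f S > 0" "infsum ?f S \<le> 1" using infsumI[OF f] by linarith+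
  then show ?thesis unfolding dyadic_real_def by simp
qed

text \<open>Turns counting into measure: prescribing the first \<open>N m\<close> digits confines
  \<open>x\<close> to a half-open interval of length \<open>1 / 2 ^ N m\<close>, so the summable
  ratios bound the measures of the events in the Borel-Cantelli lemma.\<close>

lemma AE_bits_eventually_notin:
  fixes \<A> :: "nat \<Rightarrow> nat set set"
  assumes sub: "\<And>m. \<A> m \<subseteq> Pow {..<N m}"
    and summ: "summable (\<lambda>m. real (card (\<A> m)) / 2 ^ N m)"
  shows "AE x in lebesgue_on {0<..1}. \<forall>\<^sub>F m in sequentially. bits x \<inter> {..<N m} \<notin> \<A> m"
proof -
  define s where "s S = (\<Sum>n\<in>S. 1 / 2 ^ Suc n :: real)" for S
  define U where "U m = (\<Union>S\<in>\<A> m. {s S<..s S + 1 / 2 ^ N m})" for m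
  have fin: "finite (\<A> m)" for m using sub finite_subset by blast
  have sets: "U m \<in> sets lebesgue" for m
    unfolding U_def using fin by (intro sets.finite_UN) auto
  have le: "emeasure lebesgue (U m) \<le> ennreal (real (card (\<A> m)) / 2 ^ N m)" for m
  proof -
    have "emeasure lebesgue (U m) \<le> (\<Sum>S\<in>\<A> m. emeasure lebesgue {s S<..s S + 1 / 2 ^ N m})"
      unfolding U_def using fin by (intro emeasure_subadditive_finite) auto
    also have "\<dots> = (\<Sum>S\<in>\<A> m. ennreal (1 / 2 ^ N m))" by simp
    also have "\<dots> = ennreal (real (card (\<A> m)) / 2 ^ N m)"
      by (subst sum_ennreal) auto
    finally show ?thesis .
  qed
  have "AE x in lebesgue. \<forall>\<^sub>F m in sequentially. x \<in> space lebesgue - U m"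
  proof (rule borel_cantelli_AE1[OF sets])
    show "emeasure lebesgue (U m) < \<infinity>" for m
      using le[of m] by (simp add: le_less_trans)
    show "summable (\<lambda>m. measure lebesgue (U m))"
      using le by (intro summable_comparison_test[OF _ summ])
        (auto simp: measure_def intro!: exI enn2real_leI)
  qed
  then have "AE x in lebesgue. x \<in> {0<..1} \<longrightarrow> (\<forall>\<^sub>F m in sequentially. bits x \<inter> {..<N m} \<notin> \<A> m)"
  proof (rule AE_mp, intro AE_I2 impI)
    fix x :: real
    assume x: "x \<in> {0<..1}" and "\<forall>\<^sub>F m in sequentially. x \<in> space lebesgue - U m"
    then show "\<forall>\<^sub>F m in sequentially. bits x \<inter> {..<N m} \<notin> \<A> m"
      \<comment> \<open>By \<open>bits_approx\<close>, \<open>x\<close> lies in the interval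
        belonging to its own prefix, so a prefix in \<open>\<A> m\<close> would put \<open>x\<close>
        into \<open>U m\<close>.\<close>
      by (elim eventually_mono) (use bits_approx[OF x] in \<open>auto simp: U_def s_def\<close>)
  qed
  then show ?thesis by (subst AE_restrict_space_iff) auto
qed

subsection \<open>Frequencies of finite patterns\<close>

text \<open>\<open>P\<close> is a set of patterns, so that an event such as "the window contains
  \<open>F\<close>" is treated in the same way as a single pattern.\<close>

definition occurrences :: "nat \<Rightarrow> nat set set \<Rightarrow> nat set \<Rightarrow> nat set" where
  "occurrences w P A = {x. {y. y < w \<and> x + y \<in> A} \<in> P}"

text \<open>Independence of disjoint blocks of fair bits in counting form: a subset of
  \<open>I \<union> J\<close> is the same as a pair of its traces.\<close>

lemma sum_Pow_Un:
  fixes f g :: "'a set \<Rightarrow> real"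
  assumes "finite I" "finite J" "I \<inter> J = {}"
  shows "(\<Sum>S\<in>Pow (I \<union> J). f (S \<inter> I) * g (S \<inter> J)) = (\<Sum>S\<in>Pow I. f S) * (\<Sum>T\<in>Pow J. g T)"
proof -
  have "(\<Sum>S\<in>Pow (I \<union> J). f (S \<inter> I) * g (S \<inter> J)) = (\<Sum>(S, T)\<in>Pow I \<times> Pow J. f S * g T)"
  proof (rule sum.reindex_bij_witness[where i = "\<lambda>(S, T). S \<union> T" and j = "\<lambda>S. (S \<inter> I, S \<inter> J)"])
    fix ST assume ST: "ST \<in> Pow I \<times> Pow J"
    then obtain S T where "ST = (S, T)" "S \<subseteq> I" "T \<subseteq> J" by auto
    then show "((case ST of (S, T) \<Rightarrow> S \<union> T) \<inter> I, (case ST of (S, T) \<Rightarrow> S \<union> T) \<inter> J) = ST"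
      "(case ST of (S, T) \<Rightarrow> S \<union> T) \<in> Pow (I \<union> J)"
      using assms(3) by auto
  qed auto
  also have "\<dots> = (\<Sum>S\<in>Pow I. f S) * (\<Sum>T\<in>Pow J. g T)"
    by (simp add: sum_product sum.cartesian_product)
  finally show ?thesis .
qed

text \<open>Translation by \<open>x\<close> matches the subsets of the window with those of
  \<open>{..<w}\<close>, and exactly \<open>card P\<close> of these lie in \<open>P\<close>.\<close>

lemma sum_window_centred:
  assumes "P \<subseteq> Pow {..<w}"
  shows "(\<Sum>S\<in>Pow {x..<x + w}. of_bool (x \<in> occurrences w P S) - real (card P) / 2 ^ w) = 0"
proof -
  have "(\<Sum>S\<in>Pow {x..<x + w}. of_bool (x \<in> occurrences w P S) - real (card P) / 2 ^ w)
      = (\<Sum>T\<in>Pow {..<w}. of_bool (T \<in> P) - real (card P) / 2 ^ w)"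
  proof (rule sum.reindex_bij_witness[where j = "\<lambda>S. {y. y < w \<and> x + y \<in> S}" and i = "\<lambda>T. (+) x ` T"])
    fix S assume "S \<in> Pow {x..<x + w}"
    then show "(+) x ` {y. y < w \<and> x + y \<in> S} = S"
      by (force simp: image_iff le_iff_add)
  qed (auto simp: occurrences_def)
  also have "\<dots> = real (card (Pow {..<w} \<inter> P)) - real (card (Pow {..<w})) * (real (card P) / 2 ^ w)"
    by (simp add: sum_subtractf Int_def)
  also have "\<dots> = 0" using assms by (simp add: card_Pow inf.absorb2)
  finally show ?thesis .
qed

lemma uncorrelated_windows:
  assumes P: "P \<subseteq> Pow {..<w}" and xy: "x + w \<le> y" "y + w \<le> M"
  defines "X \<equiv> \<lambda>x S. of_bool (x \<in> occurrences w P S) - real (card P) / 2 ^ w"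
  shows "(\<Sum>S\<in>Pow {..<M}. X x S * X y S) = 0"
proof -
  \<comment> \<open>\<open>?J\<close> is the whole complement of the first window, not just the
    second window, so that \<open>?I\<close> and \<open>?J\<close> partition \<open>{..<M}\<close>
    and \<open>sum_Pow_Un\<close> applies.\<close>
  let ?I = "{x..<x + w}" and ?J = "{..<M} - {x..<x + w}"
  have X: "X x S = X x (S \<inter> ?I)" "X y S = X y (S \<inter> ?J)" if "S \<in> Pow {..<M}" for S
  proof -
    have "{i. i < w \<and> x + i \<in> S} = {i. i < w \<and> x + i \<in> S \<inter> ?I}" by auto
    then show "X x S = X x (S \<inter> ?I)" by (simp add: X_def occurrences_def)
    have "{i. i < w \<and> y + i \<in> S} = {i. i < w \<and> y + i \<in> S \<inter> ?J}" using xy by auto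
    then show "X y S = X y (S \<inter> ?J)" by (simp add: X_def occurrences_def)
  qed
  have M: "{..<M} = ?I \<union> ?J" using xy by auto
  have "(\<Sum>S\<in>Pow {..<M}. X x S * X y S) = (\<Sum>S\<in>Pow {..<M}. X x (S \<inter> ?I) * X y (S \<inter> ?J))"
    by (intro sum.cong arg_cong2[where f = "(*)"] X refl)
  also have "\<dots> = (\<Sum>S\<in>Pow ?I. X x S) * (\<Sum>T\<in>Pow ?J. X y T)"
    by (subst M, rule sum_Pow_Un) auto
  also have "(\<Sum>S\<in>Pow ?I. X x S) = 0"
    unfolding X_def by (rule sum_window_centred[OF P])
  finally show ?thesis by simp
qed

text \<open>Expanding the square leaves only pairs of overlapping windows: at most
  \<open>2 * w\<close> partners for each of \<open>n\<close> positions, each contributing at most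
  \<open>2 ^ (n + w)\<close>. Prefixes have length \<open>n + w\<close> so that every window
  starting below \<open>n\<close> fits.\<close>

lemma second_moment_occurrences:
  assumes P: "P \<subseteq> Pow {..<w}"
  shows "(\<Sum>S\<in>Pow {..<n + w}. (real (card (occurrences w P S \<inter> {..<n})) - real n * (real (card P) / 2 ^ w))\<^sup>2)
    \<le> real n * real (2 * w) * 2 ^ (n + w)"
proof -
  define p where "p = real (card P) / 2 ^ w"
  define X where "X = (\<lambda>x S. of_bool (x \<in> occurrences w P S) - p)"
  have "card P \<le> 2 ^ w" using card_mono[OF _ P] by (simp add: card_Pow)
  then have p: "0 \<le> p" "p \<le> 1" by (simp_all add: p_def)
  have X1: "X x S * X y S \<le> 1" for x y S
  proof -
    have "\<bar>X x S * X y S\<bar> \<le> 1 * 1" unfolding abs_mult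
      using p by (intro mult_mono) (auto simp: X_def)
    then show ?thesis by simp
  qed
  have X0: "(\<Sum>S\<in>Pow {..<n + w}. X x S * X y S) = 0"
    if "x < n" "y < n" "x + w \<le> y \<or> y + w \<le> x" for x y
    using uncorrelated_windows[OF P, of x y "n + w"] uncorrelated_windows[OF P, of y x "n + w"] that
    by (auto simp: X_def p_def mult.commute)
  have cnt: "real (card (occurrences w P S \<inter> {..<n})) - real n * p = (\<Sum>x<n. X x S)" for S
    by (simp add: X_def sum_subtractf Int_commute)
  have "(\<Sum>S\<in>Pow {..<n + w}. (real (card (occurrences w P S \<inter> {..<n})) - real n * p)\<^sup>2)
      = (\<Sum>S\<in>Pow {..<n + w}. \<Sum>x<n. \<Sum>y<n. X x S * X y S)"
    unfolding cnt by (simp add: power2_eq_square sum_product)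
  also have "\<dots> = (\<Sum>x<n. \<Sum>y<n. \<Sum>S\<in>Pow {..<n + w}. X x S * X y S)"
    by (subst sum.swap, intro sum.cong refl, subst sum.swap, rule refl)
  \<comment> \<open>Also under truncated subtraction, the interval consists of the \<open>y\<close>
    at distance less than \<open>w\<close> from \<open>x\<close>.\<close>
  also have "\<dots> \<le> (\<Sum>x<n. \<Sum>y<n. if y \<in> {x+1-w..<x+w} then 2 ^ (n + w) else 0)"
  proof (intro sum_mono)
    fix x y assume xy: "x \<in> {..<n}" "y \<in> {..<n}"
    have "(\<Sum>S\<in>Pow {..<n + w}. X x S * X y S) \<le> (\<Sum>S\<in>Pow {..<n + w}. 1)"
      by (intro sum_mono X1)
    then have "(\<Sum>S\<in>Pow {..<n + w}. X x S * X y S) \<le> 2 ^ (n + w)" by (simp add: card_Pow)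
    moreover have "(\<Sum>S\<in>Pow {..<n + w}. X x S * X y S) = 0" if "y \<notin> {x+1-w..<x+w}"
      using xy that by (intro X0) auto
    ultimately show "(\<Sum>S\<in>Pow {..<n + w}. X x S * X y S) \<le> (if y \<in> {x+1-w..<x+w} then 2 ^ (n + w) else 0)"
      by auto
  qed
  also have "\<dots> \<le> (\<Sum>x<n. real (2 * w) * 2 ^ (n + w))"
  proof (intro sum_mono)
    fix x
    have "card ({..<n} \<inter> {x+1-w..<x+w}) \<le> card {x+1-w..<x+w}" by (intro card_mono) auto
    then have "card ({..<n} \<inter> {x+1-w..<x+w}) \<le> 2 * w" by simp
    then show "(\<Sum>y<n. if y \<in> {x+1-w..<x+w} then 2 ^ (n + w) else 0) \<le> real (2 * w) * 2 ^ (n + w)"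
      by (simp only: sum.If_cases finite_lessThan Collect_mem_eq) (simp add: mult_right_mono del: of_nat_mult)
  qed
  finally show ?thesis by (simp add: p_def)
qed

section \<open>Almost sure pattern frequencies from Chebyshev's inequality\<close>

lemma summable_inverse_pow2: "summable (\<lambda>m. c / 2 ^ m :: real)"
  using summable_mult[OF summable_geometric[of "1/2::real"], of c] by (simp add: power_one_over)

lemma card_deviation_bound:
  fixes Y :: "'a \<Rightarrow> real"
  assumes "finite V" "d > 0"
  shows "real (card {S \<in> V. d \<le> \<bar>Y S\<bar>}) \<le> (\<Sum>S\<in>V. (Y S)\<^sup>2) / d\<^sup>2"
proof -
  have "real (card {S \<in> V. d \<le> \<bar>Y S\<bar>}) * d\<^sup>2 = (\<Sum>S\<in>{S \<in> V. d \<le> \<bar>Y S\<bar>}. d\<^sup>2)" by simp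
  also have "\<dots> \<le> (\<Sum>S\<in>{S \<in> V. d \<le> \<bar>Y S\<bar>}. (Y S)\<^sup>2)"
  proof (intro sum_mono)
    fix S assume "S \<in> {S \<in> V. d \<le> \<bar>Y S\<bar>}"
    then have "d\<^sup>2 \<le> \<bar>Y S\<bar>\<^sup>2" using assms(2) by (intro power_mono) auto
    then show "d\<^sup>2 \<le> (Y S)\<^sup>2" by simp
  qed
  also have "\<dots> \<le> (\<Sum>S\<in>V. (Y S)\<^sup>2)"
    using assms(1) by (intro sum_mono2) auto
  finally show ?thesis using assms(2) by (simp add: field_simps)
qed

lemma AE_occurrences_density:
  assumes P: "P \<subseteq> Pow {..<w}" and \<delta>: "\<delta> > 0"
  shows "AE x in lebesgue_on {0<..1}. \<forall>\<^sub>F m in sequentially.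
    \<bar>real (card (occurrences w P (bits x) \<inter> {..<32 * 2 ^ m})) - 32 * 2 ^ m * (real (card P) / 2 ^ w)\<bar> < \<delta> * 2 ^ m"
proof -
  define Y where "Y m S = real (card (occurrences w P S \<inter> {..<32 * 2 ^ m})) - 32 * 2 ^ m * (real (card P) / 2 ^ w)"
    for m :: nat and S
  define N where "N m = 32 * 2 ^ m + w" for m
  define \<A> where "\<A> m = {S \<in> Pow {..<N m}. \<delta> * 2 ^ m \<le> \<bar>Y m S\<bar>}" for m
  \<comment> \<open>The windows counted by \<open>Y m\<close> end before \<open>N m\<close>, so a
    deviation is an event about the first \<open>N m\<close> digits.\<close>
  have local: "Y m (A \<inter> {..<N m}) = Y m A" for m A
  proof -
    have "{y. y < w \<and> x + y \<in> A \<inter> {..<N m}} = {y. y < w \<and> x + y \<in> A}" if "x < 32 * 2 ^ m" for x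
      using that by (auto simp: N_def)
    then have "x \<in> occurrences w P (A \<inter> {..<N m}) \<longleftrightarrow> x \<in> occurrences w P A" if "x < 32 * 2 ^ m" for x
      unfolding occurrences_def mem_Collect_eq using that by (simp only:)
    then have "occurrences w P (A \<inter> {..<N m}) \<inter> {..<32 * 2 ^ m} = occurrences w P A \<inter> {..<32 * 2 ^ m}"
      by blast
    then show ?thesis by (simp add: Y_def)
  qed
  have bound: "real (card (\<A> m)) / 2 ^ N m \<le> 64 * w / \<delta>\<^sup>2 / 2 ^ m" for m
  proof -
    have "real (card (\<A> m)) \<le> (\<Sum>S\<in>Pow {..<N m}. (Y m S)\<^sup>2) / (\<delta> * 2 ^ m)\<^sup>2"
      unfolding \<A>_def using \<delta> by (intro card_deviation_bound) auto
    also have "\<dots> \<le> real (32 * 2 ^ m) * real (2 * w) * 2 ^ N m / (\<delta> * 2 ^ m)\<^sup>2"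
      using second_moment_occurrences[OF P, of "32 * 2 ^ m"]
      unfolding N_def Y_def by (intro divide_right_mono) simp_all
    also have "\<dots> = 64 * w / \<delta>\<^sup>2 / 2 ^ m * 2 ^ N m"
      using \<delta> by (simp add: power2_eq_square)
    finally show ?thesis by (simp add: pos_divide_le_eq)
  qed
  have "summable (\<lambda>m. real (card (\<A> m)) / 2 ^ N m)"
    using bound by (intro summable_comparison_test'[OF summable_inverse_pow2[of "64 * w / \<delta>\<^sup>2"], of 0]) simp
  then have "AE x in lebesgue_on {0<..1}. \<forall>\<^sub>F m in sequentially. bits x \<inter> {..<N m} \<notin> \<A> m"
    by (intro AE_bits_eventually_notin) (auto simp: \<A>_def)
  then show ?thesis
  proof (rule AE_mp, intro AE_I2 impI)
    fix x :: real assume "\<forall>\<^sub>F m in sequentially. bits x \<inter> {..<N m} \<notin> \<A> m"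
    then have "\<forall>\<^sub>F m in sequentially. \<bar>Y m (bits x)\<bar> < \<delta> * 2 ^ m"
      by (rule eventually_mono) (auto simp: \<A>_def local)
    then show "\<forall>\<^sub>F m in sequentially.
      \<bar>real (card (occurrences w P (bits x) \<inter> {..<32 * 2 ^ m})) - 32 * 2 ^ m * (real (card P) / 2 ^ w)\<bar> < \<delta> * 2 ^ m"
      unfolding Y_def .
  qed
qed

text \<open>Normality in base 2, tested only along the lengths \<open>32 * 2 ^ m\<close>. The
  tolerances \<open>1 / real (Suc k)\<close> keep all quantifiers countable, so that the exceptional
  null sets can be united.\<close>

definition pattern_normal :: "nat set \<Rightarrow> bool" where
  "pattern_normal A \<longleftrightarrow> (\<forall>w. \<forall>P\<in>Pow (Pow {..<w}). \<forall>k. \<forall>\<^sub>F m in sequentially.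
     \<bar>real (card (occurrences w P A \<inter> {..<32 * 2 ^ m})) - 32 * 2 ^ m * (real (card P) / 2 ^ w)\<bar>
       < 1 / real (Suc k) * 2 ^ m)"

lemma AE_pattern_normal: "AE x in lebesgue_on {0<..1}. pattern_normal (bits x)"
  unfolding pattern_normal_def
proof (subst AE_all_countable, rule allI)
  fix w
  have "countable (Pow (Pow {..<w :: nat}))" by (intro countable_finite) simp
  then show "AE x in lebesgue_on {0<..1}. \<forall>P\<in>Pow (Pow {..<w}). \<forall>k. \<forall>\<^sub>F m in sequentially.
     \<bar>real (card (occurrences w P (bits x) \<inter> {..<32 * 2 ^ m})) - 32 * 2 ^ m * (real (card P) / 2 ^ w)\<bar>
       < 1 / real (Suc k) * 2 ^ m"
    by (subst AE_ball_countable) (auto simp only: AE_all_countable Pow_iff intro!: AE_occurrences_density, simp_all)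
qed

lemma pattern_normalD:
  assumes "pattern_normal A" "P \<subseteq> Pow {..<w}" "\<delta> > 0"
  shows "\<forall>\<^sub>F m in sequentially.
     \<bar>real (card (occurrences w P A \<inter> {..<32 * 2 ^ m})) - 32 * 2 ^ m * (real (card P) / 2 ^ w)\<bar> < \<delta> * 2 ^ m"
proof -
  obtain k where k: "1 / real (Suc k) < \<delta>"
    using reals_Archimedean[OF assms(3)] by (auto simp: inverse_eq_divide)
  have "\<forall>\<^sub>F m in sequentially.
     \<bar>real (card (occurrences w P A \<inter> {..<32 * 2 ^ m})) - 32 * 2 ^ m * (real (card P) / 2 ^ w)\<bar>
       < 1 / real (Suc k) * 2 ^ m"
    using assms(1,2) unfolding pattern_normal_def by blast
  then show ?thesis
  proof (rule eventually_mono)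
    fix m
    have "1 / real (Suc k) * 2 ^ m \<le> \<delta> * 2 ^ m" using k by (intro mult_right_mono) auto
    then show "\<bar>z\<bar> < \<delta> * 2 ^ m" if "\<bar>z\<bar> < 1 / real (Suc k) * 2 ^ m" for z :: real
      using that by linarith
  qed
qed

subsection \<open>Counting sums of sparse sets\<close>

text \<open>The binomial theorem, obtained by expanding a product of \<open>card V\<close> factors
  \<open>1 + t\<close> over subsets.\<close>

lemma sum_Pow_power_card:
  assumes "finite V"
  shows "(\<Sum>S\<in>Pow V. t ^ card S) = (1 + t :: real) ^ card V"
  using prod_add[OF assms, of "\<lambda>_. t" "\<lambda>_. 1"] by (simp add: add.commute)

definition small_subsets :: "nat \<Rightarrow> nat \<Rightarrow> nat set set" where
  "small_subsets n q = {S \<in> Pow {..<n}. card S \<le> q}"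

lemma finite_small_subsets: "finite (small_subsets n q)"
  by (simp add: small_subsets_def)

text \<open>Exponential Markov inequality with weight \<open>(1/8)^card S\<close>; the base \<open>1/8\<close> makes the cube of the
  bound, for \<open>n = 32 q\<close>, smaller than \<open>2^n\<close>.\<close>

lemma card_small_subsets: "real (card (small_subsets n q)) \<le> (9/8) ^ n * 8 ^ q"
proof -
  have "real (card (small_subsets n q)) * (1/8) ^ q = (\<Sum>S\<in>small_subsets n q. (1/8) ^ q)" by simp
  also have "\<dots> \<le> (\<Sum>S\<in>small_subsets n q. (1/8) ^ card S)"
    by (intro sum_mono power_decreasing) (auto simp: small_subsets_def)
  also have "\<dots> \<le> (\<Sum>S\<in>Pow {..<n}. (1/8) ^ card S)"
    by (intro sum_mono2) (auto simp: small_subsets_def)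
  also have "\<dots> = (9/8) ^ n" by (simp add: sum_Pow_power_card)
  finally show ?thesis by (simp add: power_one_over field_simps)
qed

text \<open>\<open>E\<close> is the error set: taking the symmetric difference with it turns the
  truncated sumset back into the prefix of \<open>A\<close>.\<close>

definition sparse_sumsets :: "nat \<Rightarrow> nat \<Rightarrow> nat set set" where
  "sparse_sumsets n q = (\<lambda>(B, C, E). ((B + C) \<inter> {..<n} - E) \<union> (E - (B + C) \<inter> {..<n}))
     ` (small_subsets n q \<times> small_subsets n q \<times> small_subsets n q)"

lemma card_sparse_sumsets: "real (card (sparse_sumsets (32 * q) q)) / 2 ^ (32 * q) \<le> (1/2) ^ q"
proof -
  let ?s = "card (small_subsets (32 * q) q)"
  have "card (sparse_sumsets (32 * q) q) \<le> ?s * (?s * ?s)"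
    unfolding sparse_sumsets_def
    by (rule order_trans[OF card_image_le]) (simp_all add: finite_small_subsets card_cartesian_product)
  then have "real (card (sparse_sumsets (32 * q) q)) \<le> real ?s ^ 3"
    by (simp add: power3_eq_cube mult.assoc flip: of_nat_mult)
  also have "\<dots> \<le> ((9/8) ^ (32 * q) * 8 ^ q) ^ 3"
    by (intro power_mono card_small_subsets) simp
  also have "(9/8) ^ (32 * q) * 8 ^ q = ((9/8) ^ 32 * 8 :: real) ^ q"
    by (simp only: power_mult power_mult_distrib)
  also have "(((9/8) ^ 32 * 8 :: real) ^ q) ^ 3 = (((9/8) ^ 32 * 8) ^ 3) ^ q"
    by (simp only: power_mult[symmetric] mult.commute)
  \<comment> \<open>Numerically \<open>(9/8) ^ 96 * 8 ^ 3 \<le> 2 ^ 31\<close>, which saves a factor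
    2 for each unit of \<open>q\<close>.\<close>
  also have "\<dots> \<le> (2 ^ 32 * (1/2)) ^ q"
    by (intro power_mono) (simp_all add: power_divide)
  also have "\<dots> = (1/2) ^ q * 2 ^ (32 * q)"
    unfolding power_mult[of _ 32 q] power_mult_distrib by (rule mult.commute)
  finally show ?thesis by (simp only: pos_divide_le_eq zero_less_power zero_less_numeral)
qed

lemma AE_not_sparse_sumset:
  "AE x in lebesgue_on {0<..1}. \<forall>\<^sub>F m in sequentially.
     bits x \<inter> {..<32 * 2 ^ m} \<notin> sparse_sumsets (32 * 2 ^ m) (2 ^ m)"
proof (rule AE_bits_eventually_notin)
  show "summable (\<lambda>m. real (card (sparse_sumsets (32 * 2 ^ m) (2 ^ m))) / 2 ^ (32 * 2 ^ m))"
  proof (rule summable_comparison_test[OF _ summable_inverse_pow2[of 1]], intro exI allI impI)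
    fix m :: nat
    have "(1/2 :: real) ^ (2 ^ m) \<le> (1/2) ^ m" by (intro power_decreasing) (simp_all add: less_imp_le)
    then show "norm (real (card (sparse_sumsets (32 * 2 ^ m) (2 ^ m))) / 2 ^ (32 * 2 ^ m)) \<le> 1 / 2 ^ m"
      using card_sparse_sumsets[of "2 ^ m"] by (simp add: power_one_over)
  qed
qed (auto simp: sparse_sumsets_def small_subsets_def)

subsection \<open>Sumsets up to density zero\<close>

text \<open>Puts density zero into the form used along the lengths \<open>32 * 2 ^ m\<close>; the
  margin \<open>w\<close> makes room for translates of the error set by less than
  \<open>w\<close>.\<close>

lemma density_zero_idealD:
  assumes "E \<in> \<Z>" "\<epsilon> > 0"
  shows "\<forall>\<^sub>F m in sequentially. real (card (E \<inter> {..<32 * 2 ^ m + w})) \<le> \<epsilon> * 2 ^ m"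
proof -
  define n where "n m = 32 * 2 ^ m + w" for m
  have "strict_mono n" by (auto simp: n_def strict_mono_def)
  moreover have "(\<lambda>n. real (card (E \<inter> {0..n})) / real n) \<longlonglongrightarrow> 0"
    using assms(1) by (simp add: density_zero_ideal_def)
  ultimately have "(\<lambda>m. real (card (E \<inter> {0..n m})) / real (n m)) \<longlonglongrightarrow> 0"
    by (auto dest: LIMSEQ_subseq_LIMSEQ simp: o_def)
  \<comment> \<open>The divisor \<open>32 + w\<close> is chosen because
    \<open>n m \<le> (32 + w) * 2 ^ m\<close>.\<close>
  then have "\<forall>\<^sub>F m in sequentially. real (card (E \<inter> {0..n m})) / real (n m) < \<epsilon> / (32 + w)"
    using assms(2) by (intro order_tendstoD) auto
  then show ?thesis
  proof (rule eventually_mono)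
    fix m
    assume *: "real (card (E \<inter> {0..n m})) / real (n m) < \<epsilon> / (32 + w)"
    have n: "n m > 0" "real (n m) \<le> (32 + w) * 2 ^ m"
      by (auto simp: n_def algebra_simps mult_le_cancel_left1)
    have "card (E \<inter> {..<n m}) \<le> card (E \<inter> {0..n m})" by (intro card_mono) auto
    then have "real (card (E \<inter> {..<n m})) \<le> real (card (E \<inter> {0..n m}))" by simp
    also have "\<dots> \<le> \<epsilon> / (32 + w) * real (n m)" using * n(1) by (simp add: pos_divide_less_eq)
    also have "\<dots> \<le> \<epsilon> / (32 + w) * ((32 + w) * 2 ^ m)" using n(2) assms(2) by (intro mult_left_mono) auto
    also have "\<dots> = \<epsilon> * 2 ^ m" by simp
    finally show "real (card (E \<inter> {..<32 * 2 ^ m + w})) \<le> \<epsilon> * 2 ^ m" by (simp add: n_def)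
  qed
qed

text \<open>A superset \<open>T\<close> of \<open>F\<close> is determined by \<open>T - F\<close>,
  an arbitrary subset of \<open>V - F\<close>.\<close>

lemma card_supersets:
  assumes "finite V" "F \<subseteq> V"
  shows "card {T \<in> Pow V. F \<subseteq> T} = 2 ^ (card V - card F)"
proof -
  have "bij_betw (\<lambda>U. F \<union> U) (Pow (V - F)) {T \<in> Pow V. F \<subseteq> T}"
    by (rule bij_betw_byWitness[where f' = "\<lambda>T. T - F"]) (use assms(2) in auto)
  then show ?thesis
    using assms by (simp add: bij_betw_same_card[symmetric] card_Pow card_Diff_subset finite_subset)
qed

lemma card_shifted_le:
  assumes "b < w"
  shows "card {c \<in> {..<n}. c + b \<in> E} \<le> card (E \<inter> {..<n + w :: nat})"
  by (rule card_inj_on_le[where f = "\<lambda>c. c + b"]) (use assms in \<open>auto simp: inj_on_def\<close>)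

lemma summand_sparse:
  assumes A: "pattern_normal A" and B: "infinite B"
    and E: "(A - (B + C)) \<union> ((B + C) - A) \<in> \<Z>" (is "?E \<in> \<Z>")
  shows "\<forall>\<^sub>F m in sequentially. card (C \<inter> {..<32 * 2 ^ m}) \<le> 2 ^ m"
proof -
  \<comment> \<open>Six elements give density 1/64, hence about \<open>2 ^ m / 2\<close> positions
    below \<open>32 * 2 ^ m\<close>. The deviation takes \<open>2 ^ m / 4\<close>, and six
    translates of the error set at \<open>2 ^ m / 24\<close> each take the remaining
    quarter.\<close>
  obtain F where F: "F \<subseteq> B" "finite F" "card F = 6"
    using infinite_arbitrarily_large[OF B] by metis
  then obtain w where w: "F \<subseteq> {..<w}" by (meson finite_nat_iff_bounded)
  define P where "P = {T \<in> Pow {..<w}. F \<subseteq> T}"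
  have "6 \<le> w" using card_mono[OF _ w] F(3) by simp
  then have "2 ^ w = (2 ^ 6 :: real) * 2 ^ (w - 6)" by (metis le_add_diff_inverse power_add)
  moreover have "card P = 2 ^ (w - 6)"
    using card_supersets[OF _ w] F(3) by (simp add: P_def del: Pow_iff)
  ultimately have P: "real (card P) / 2 ^ w = 1 / 64" by simp
  have "\<forall>\<^sub>F m in sequentially. \<bar>real (card (occurrences w P A \<inter> {..<32 * 2 ^ m})) - 32 * 2 ^ m * (1 / 64)\<bar> < 1/4 * 2 ^ m"
  proof -
    have "P \<subseteq> Pow {..<w}" by (auto simp: P_def)
    from pattern_normalD[OF A this, of "1/4"] show ?thesis unfolding P by simp
  qed
  moreover have "\<forall>\<^sub>F m in sequentially. real (card (?E \<inter> {..<32 * 2 ^ m + w})) \<le> 1/24 * 2 ^ m"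
    by (rule density_zero_idealD[OF E]) simp
  ultimately show ?thesis
  proof eventually_elim
    fix m :: nat
    let ?n = "32 * 2 ^ m :: nat"
    assume occ: "\<bar>real (card (occurrences w P A \<inter> {..<?n})) - 32 * 2 ^ m * (1 / 64)\<bar> < 1/4 * 2 ^ m"
      and err: "real (card (?E \<inter> {..<?n + w})) \<le> 1/24 * 2 ^ m"
    \<comment> \<open>For \<open>c\<close> in \<open>C\<close> the translate \<open>c + F\<close>
      lies in \<open>B + C\<close>; it lies inside \<open>A\<close> or meets the error set.\<close>
    have "C \<inter> {..<?n} \<subseteq> (occurrences w P A \<inter> {..<?n}) \<union> (\<Union>b\<in>F. {c \<in> {..<?n}. c + b \<in> ?E})"
    proof
      fix c assume c: "c \<in> C \<inter> {..<?n}"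
      have sum: "c + b \<in> B + C" if "b \<in> F" for b
        using that c F(1) by (metis IntD1 add.commute set_plus_intro subsetD)
      show "c \<in> (occurrences w P A \<inter> {..<?n}) \<union> (\<Union>b\<in>F. {c \<in> {..<?n}. c + b \<in> ?E})"
      proof (cases "\<forall>b\<in>F. c + b \<in> A")
        case True
        then show ?thesis using c w by (auto simp: occurrences_def P_def)
      next
        case False
        then show ?thesis using c sum by blast
      qed
    qed
    then have "card (C \<inter> {..<?n}) \<le> card ((occurrences w P A \<inter> {..<?n}) \<union> (\<Union>b\<in>F. {c \<in> {..<?n}. c + b \<in> ?E}))"
      using F(2) by (intro card_mono) auto
    also have "\<dots> \<le> card (occurrences w P A \<inter> {..<?n}) + (\<Sum>b\<in>F. card {c \<in> {..<?n}. c + b \<in> ?E})"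
      by (rule order_trans[OF card_Un_le add_left_mono[OF card_UN_le[OF F(2)]]])
    also have "\<dots> \<le> card (occurrences w P A \<inter> {..<?n}) + (\<Sum>b\<in>F. card (?E \<inter> {..<?n + w}))"
      using w by (intro add_left_mono sum_mono card_shifted_le) auto
    also have "\<dots> = card (occurrences w P A \<inter> {..<?n}) + 6 * card (?E \<inter> {..<?n + w})"
      by (simp add: F(3))
    finally have "real (card (C \<inter> {..<?n})) \<le> real (card (occurrences w P A \<inter> {..<?n}) + 6 * card (?E \<inter> {..<?n + w}))"
      by (simp only: of_nat_le_iff)
    also have "\<dots> = real (card (occurrences w P A \<inter> {..<?n})) + 6 * real (card (?E \<inter> {..<?n + w}))"
      by (simp only: of_nat_add of_nat_mult of_nat_numeral)
    also have "\<dots> \<le> 2 ^ m"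
      using occ err by linarith
    finally show "card (C \<inter> {..<?n}) \<le> 2 ^ m"
      by (simp only: of_nat_le_numeral_power_cancel_iff)
  qed
qed

text \<open>Every isolated element of \<open>A\<close> forces an error in its window: it is missing
  from \<open>B + C\<close>, or it equals \<open>b + c\<close> and then a nearby
  \<open>b' + c\<close> is missing from \<open>A\<close>. Isolated elements are too frequent for
  that.\<close>

lemma finite_summand_impossible:
  assumes A: "pattern_normal A" and B: "finite B" "card B \<ge> 2"
    and E: "(A - (B + C)) \<union> ((B + C) - A) \<in> \<Z>" (is "?E \<in> \<Z>")
  shows False
proof -
  define L where "L = Max B"
  have L: "b \<le> L" if "b \<in> B" for b using B that by (simp add: L_def)
  define w where "w = 2 * L + 1"
  define \<epsilon> :: real where "\<epsilon> = 1 / 2 ^ w"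
  have "\<epsilon> > 0" by (simp add: \<epsilon>_def)
  \<comment> \<open>The pattern \<open>{L}\<close> in a window of length \<open>2 L + 1\<close> is an element of \<open>A\<close> at the centre with no
    other element of \<open>A\<close> within distance \<open>L\<close>.\<close>
  have P: "{{L}} \<subseteq> Pow {..<w}" by (simp add: w_def)
  have "\<forall>\<^sub>F m in sequentially. \<bar>real (card (occurrences w {{L}} A \<inter> {..<32 * 2 ^ m})) - 32 * 2 ^ m * \<epsilon>\<bar> < \<epsilon> * 2 ^ m"
    using pattern_normalD[OF A P \<open>\<epsilon> > 0\<close>] by (simp add: \<epsilon>_def)
  \<comment> \<open>The \<open>w\<close> translates of the error set then cover at most
    \<open>\<epsilon> * 2 ^ m\<close> positions, against more than
    \<open>31 * \<epsilon> * 2 ^ m\<close> occurrences.\<close>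
  moreover have "\<forall>\<^sub>F m in sequentially. real (card (?E \<inter> {..<32 * 2 ^ m + w})) \<le> \<epsilon> / w * 2 ^ m"
    using \<open>\<epsilon> > 0\<close> by (intro density_zero_idealD[OF E]) (simp add: w_def)
  ultimately have "\<forall>\<^sub>F m :: nat in sequentially. False"
  proof eventually_elim
    fix m :: nat
    let ?n = "32 * 2 ^ m :: nat"
    assume occ: "\<bar>real (card (occurrences w {{L}} A \<inter> {..<?n})) - 32 * 2 ^ m * \<epsilon>\<bar> < \<epsilon> * 2 ^ m"
      and err: "real (card (?E \<inter> {..<?n + w})) \<le> \<epsilon> / w * 2 ^ m"
    have "occurrences w {{L}} A \<inter> {..<?n} \<subseteq> (\<Union>y\<in>{..<w}. {x \<in> {..<?n}. x + y \<in> ?E})"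
    proof
      fix x assume x: "x \<in> occurrences w {{L}} A \<inter> {..<?n}"
      then have iso: "x + y \<in> A \<longleftrightarrow> y = L" if "y < w" for y
        using that by (auto simp: occurrences_def)
      have "L < w" by (simp add: w_def)
      have "\<exists>y<w. x + y \<in> ?E"
      proof (cases "x + L \<in> B + C")
        case False
        then show ?thesis using iso[OF \<open>L < w\<close>] \<open>L < w\<close> by blast
      next
        case True
        then obtain b c where bc: "b \<in> B" "c \<in> C" "x + L = b + c"
          by (auto elim: set_plus_elim)
        obtain b' where b': "b' \<in> B" "b' \<noteq> b"
          using B by (metis card_le_Suc0_iff_eq not_less_eq_eq numeral_2_eq_2)
        \<comment> \<open>The position of \<open>b' + c\<close> in the window starting at
          \<open>x\<close>. The subtraction is exact since \<open>b \<le> L\<close>, and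
          \<open>b' \<le> L\<close> keeps \<open>y\<close> below \<open>w\<close>.\<close>
        define y where "y = L + b' - b"
        have "x + y = b' + c" "y < w" "y \<noteq> L"
          using bc b' L[OF bc(1)] L[OF b'(1)] by (auto simp: y_def w_def)
        then have "x + y \<in> B + C" "x + y \<notin> A" "y < w"
          using iso[of y] set_plus_intro[OF b'(1) bc(2)] by simp_all
        then show ?thesis by blast
      qed
      then show "x \<in> (\<Union>y\<in>{..<w}. {x \<in> {..<?n}. x + y \<in> ?E})" using x by blast
    qed
    then have "card (occurrences w {{L}} A \<inter> {..<?n}) \<le> card (\<Union>y\<in>{..<w}. {x \<in> {..<?n}. x + y \<in> ?E})"
      by (intro card_mono) auto
    also have "\<dots> \<le> (\<Sum>y<w. card {x \<in> {..<?n}. x + y \<in> ?E})"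
      by (rule card_UN_le) simp
    also have "\<dots> \<le> (\<Sum>y<w. card (?E \<inter> {..<?n + w}))"
      by (intro sum_mono card_shifted_le) auto
    also have "\<dots> = w * card (?E \<inter> {..<?n + w})" by simp
    finally have "real (card (occurrences w {{L}} A \<inter> {..<?n})) \<le> w * real (card (?E \<inter> {..<?n + w}))"
      unfolding of_nat_mult[symmetric] of_nat_le_iff .
    also have "\<dots> \<le> w * (\<epsilon> / w * 2 ^ m)" by (intro mult_left_mono err) simp
    also have "\<dots> = \<epsilon> * 2 ^ m" by (simp add: w_def)
    finally have "31 * (\<epsilon> * 2 ^ m) \<le> \<epsilon> * 2 ^ m" using occ by (simp add: algebra_simps abs_less_iff)
    moreover have "\<epsilon> * 2 ^ m > 0" using \<open>\<epsilon> > 0\<close> by simp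
    ultimately show False by linarith
  qed
  then show False by simp
qed

section \<open>From the almost sure properties to membership in \<open>\<Sigma> \<Z>\<close> and
  full measure\<close>

lemma pattern_normal_in_Sigma:
  assumes A: "pattern_normal A"
    and sparse: "\<forall>\<^sub>F m in sequentially. A \<inter> {..<32 * 2 ^ m} \<notin> sparse_sumsets (32 * 2 ^ m) (2 ^ m)"
  shows "A \<in> \<Sigma> \<Z>"
proof (rule ccontr)
  assume "A \<notin> \<Sigma> \<Z>"
  then obtain B C where BC: "at_least_two B" "at_least_two C"
    and E: "(A - (B + C)) \<union> ((B + C) - A) \<in> \<Z>" (is "?E \<in> \<Z>")
    unfolding Sigma_class_def by blast
  have E': "(A - (C + B)) \<union> ((C + B) - A) \<in> \<Z>" using E by (simp add: add.commute)
  have "infinite B" "infinite C"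
    using finite_summand_impossible[OF A _ _ E] finite_summand_impossible[OF A _ _ E'] BC
    by (auto simp: at_least_two_def)
  then have "\<forall>\<^sub>F m in sequentially. card (C \<inter> {..<32 * 2 ^ m}) \<le> 2 ^ m"
    "\<forall>\<^sub>F m in sequentially. card (B \<inter> {..<32 * 2 ^ m}) \<le> 2 ^ m"
    using summand_sparse[OF A _ E] summand_sparse[OF A _ E'] by blast+
  moreover have "\<forall>\<^sub>F m in sequentially. real (card (?E \<inter> {..<32 * 2 ^ m + 0})) \<le> 1 * 2 ^ m"
    by (rule density_zero_idealD[OF E]) simp
  ultimately have "\<forall>\<^sub>F m :: nat in sequentially. False" using sparse
  proof eventually_elim
    fix m :: nat
    let ?n = "32 * 2 ^ m :: nat"
    let ?B = "B \<inter> {..<?n}" and ?C = "C \<inter> {..<?n}" and ?D = "?E \<inter> {..<?n}"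
    assume small: "card ?C \<le> 2 ^ m" "card ?B \<le> 2 ^ m" "real (card (?E \<inter> {..<?n + 0})) \<le> 1 * 2 ^ m"
      and nsparse: "A \<inter> {..<?n} \<notin> sparse_sumsets ?n (2 ^ m)"
    have "card ?D \<le> 2 ^ m"
      using small(3) by (simp only: add_0_right mult_1 of_nat_le_numeral_power_cancel_iff)
    then have mem: "?B \<in> small_subsets ?n (2 ^ m)" "?C \<in> small_subsets ?n (2 ^ m)" "?D \<in> small_subsets ?n (2 ^ m)"
      unfolding small_subsets_def using small(1,2) by simp_all
    \<comment> \<open>Truncating the summands loses nothing below \<open>?n\<close>, since
      \<open>b + c < ?n\<close> forces both \<open>b\<close> and \<open>c\<close> below
      \<open>?n\<close>.\<close>
    have BC: "(?B + ?C) \<inter> {..<?n} = (B + C) \<inter> {..<?n}"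
    proof (intro equalityI subsetI)
      fix x assume "x \<in> (B + C) \<inter> {..<?n}"
      then obtain b c where bc: "b \<in> B" "c \<in> C" "x = b + c" "x < ?n"
        by (auto elim: set_plus_elim)
      then have "b \<in> ?B" "c \<in> ?C" by simp_all
      then show "x \<in> (?B + ?C) \<inter> {..<?n}" using set_plus_intro bc(3,4) by blast
    next
      fix x assume "x \<in> (?B + ?C) \<inter> {..<?n}"
      then show "x \<in> (B + C) \<inter> {..<?n}" using set_plus_mono2[of ?B B ?C C] by blast
    qed
    \<comment> \<open>Symmetric difference is an involution, so \<open>B + C\<close> and the error
      set together recover \<open>A\<close>.\<close>
    have "A \<inter> {..<?n} = ((?B + ?C) \<inter> {..<?n} - ?D) \<union> (?D - (?B + ?C) \<inter> {..<?n})"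
      unfolding BC by blast
    then have "A \<inter> {..<?n} \<in> sparse_sumsets ?n (2 ^ m)"
      unfolding sparse_sumsets_def by (intro image_eqI[of _ _ "(?B, ?C, ?D)"]) (simp_all only: prod.case mem_Sigma_iff mem simp_thms)
    then show False using nsparse by contradiction
  qed
  then show False by simp
qed

theorem theorem1p5:
  shows "dyadic_real ` {S. infinite S \<and> S \<in> \<Sigma> \<Z>} \<in> sets (lebesgue_on {0<..1})
    \<and> emeasure (lebesgue_on {0<..1}) (dyadic_real ` {S. infinite S \<and> S \<in> \<Sigma> \<Z>}) = 1"
proof -
  let ?M = "lebesgue_on {0<..1::real}" and ?I = "dyadic_real ` {S. infinite S \<and> S \<in> \<Sigma> \<Z>}"
  have space: "space ?M = {0<..1}" by simp
  have I: "?I \<subseteq> {0<..1}" using dyadic_real_mem by blast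
  have "AE x in ?M. bits x \<in> \<Sigma> \<Z>"
    using AE_pattern_normal AE_not_sparse_sumset
    by eventually_elim (rule pattern_normal_in_Sigma)
  then have AE: "AE x in ?M. x \<in> ?I"
  proof (rule AE_mp, intro AE_I2 impI)
    fix x assume "x \<in> space ?M" "bits x \<in> \<Sigma> \<Z>"
    then show "x \<in> ?I"
      unfolding space using dyadic_real_bits[symmetric] infinite_bits by blast
  qed
  then have "AE x in lebesgue. x \<in> {0<..1} \<longrightarrow> x \<in> ?I"
    by (subst (asm) AE_restrict_space_iff) auto
  then obtain N where N: "N \<in> null_sets lebesgue" and sub: "{x \<in> space lebesgue. \<not> (x \<in> {0<..1} \<longrightarrow> x \<in> ?I)} \<subseteq> N"
    unfolding eventually_ae_filter by blast
  \<comment> \<open>Measurability comes from completeness: the complement of \<open>?I\<close> in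
    \<open>(0,1]\<close> is contained in a Lebesgue null set.\<close>
  have "{0<..1} - ?I \<subseteq> N" using sub by auto
  then have "{0<..1} - ?I \<in> sets lebesgue"
    using N null_sets_completion_subset by blast
  then have "{0<..1} - ({0<..1} - ?I) \<in> sets lebesgue" by (rule sets.Diff[rotated]) simp
  then have "?I \<in> sets lebesgue" unfolding double_diff[OF I subset_refl] .
  then have sets: "?I \<in> sets ?M" using I by (subst sets_restrict_space_iff) auto
  have "emeasure ?M ?I = emeasure ?M (space ?M)"
    by (rule emeasure_eq_AE[OF _ sets]) (use AE in auto)
  also have "\<dots> = 1" by (simp add: emeasure_restrict_space)
  finally show ?thesis using sets by blast
qed

end
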